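(* Let $(C,D)$ be a Top couple and let $H$, $H'$ be two objects of $C$. A $C$-morphism $f:H\to H'$ induces a continuous map $c(f):\mathrm{Spec}(H')\to \mathrm{Spec}(H)$ by setting $c(f)(P)=f^{-1}(P)$.
   Context: For elements $a,b$ of a group, $[a,b]=aba^{-1}b^{-1}$; for subgroups $U,V$ of a group $H$, $[U,V]$ is the normal subgroup of $H$ generated by all $[u,v]$, $u\in U$, $v\in V$; $1$ also denotes the trivial subgroup. Let $C$ be a subcategory of the category of groups and $D$ a subclass of the class of objects of $C$. An ideal of an object $H$ of $C$ is a normal subgroup $I$ of $H$ such that $H/I$ is an object of $C$ and the projection $H\to H/I$ is a morphism of $C$. A prime ideal of $H$ is an ideal $P$ of $H$ with $P\neq H$ and $H/P\in D$. The pair $(C,D)$ is called a Top couple if: (T1) if $L$ is an object of $C$, $L'\in D$, and there is an injective $C$-morphism $L\to L'$, then $L\in D$; (T2) if $L\in D$ and $I,J$ are normal subgroups of $L$ with $[I,J]=1$, then $I=1$ or $J=1$; (T3) the inverse image of an ideal by a morphism of $C$ is an ideal. For an object $H$ of $C$, $\mathrm{Spec}(H)$ is the set of prime ideals of $H$, endowed with the topology whose closed subsets are the sets $V(I)=\{P\in \mathrm{Spec}(H): I\subset P\}$, where $I$ is a normal subgroup of $H$.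
   Formalization: Two hypotheses added, as the claim fails for general Top couples: an injective homomorphism H/I→L (I an ideal, L in D) whose composite with H→H/I is a C-morphism is itself a C-morphism; and no C-morphism goes from a trivial group to a nontrivial member of D. *)

theory Defs
  imports "HOL-Algebra.Coset" "HOL-Analysis.Abstract_Topology"
begin

section \<open>Subcategories of the category of groups\<close>

text \<open>
  The class of all groups is modelled by the groups whose elements lie in an arbitrary type 'u (the
  universe). Morphisms are extensional functions, so that two morphisms are equal iff they agree on
  the carrier of their source.
\<close>

record 'u group_cat =
  Obj :: "'u monoid set"
  Mor :: "'u monoid \<Rightarrow> 'u monoid \<Rightarrow> ('u \<Rightarrow> 'u) set"

definition ext_hom :: "'u monoid \<Rightarrow> 'u monoid \<Rightarrow> ('u \<Rightarrow> 'u) set" where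
  "ext_hom G H = hom G H \<inter> extensional (carrier G)"

definition group_subcategory :: "'u group_cat \<Rightarrow> bool" where
  "group_subcategory C \<longleftrightarrow>
     (\<forall>G\<in>Obj C. group G) \<and>
     (\<forall>G\<in>Obj C. \<forall>H\<in>Obj C. Mor C G H \<subseteq> ext_hom G H) \<and>
     (\<forall>G\<in>Obj C. (\<lambda>x\<in>carrier G. x) \<in> Mor C G G) \<and>
     (\<forall>G\<in>Obj C. \<forall>H\<in>Obj C. \<forall>K\<in>Obj C. \<forall>f\<in>Mor C G H. \<forall>g\<in>Mor C H K.
        compose (carrier G) g f \<in> Mor C G K)"

text \<open>
  The cosets that form \<^term>\<open>H Mod I\<close> are sets of elements of the universe, so for \<open>H/I\<close> to be
  an object they have to be elements of the universe themselves. This is the role of \<open>code\<close>, an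
  arbitrary map that is injective on the cosets in question. In a set-theoretic universe \<open>code\<close> is
  the map that regards a set as an element of the universe, and \<open>H/I\<close> below is the quotient group
  itself; another possible choice is a choice of coset representatives.
\<close>

definition coset_coding :: "('u set \<Rightarrow> 'u) \<Rightarrow> 'u group_cat \<Rightarrow> bool" where
  "coset_coding code C \<longleftrightarrow>
     (\<forall>H\<in>Obj C. \<forall>I. I \<lhd> H \<longrightarrow> inj_on code (carrier (H Mod I)))"

definition quot :: "('u set \<Rightarrow> 'u) \<Rightarrow> 'u monoid \<Rightarrow> 'u set \<Rightarrow> 'u monoid" where
  "quot code H I = flatten (H Mod I) code"

definition proj :: "('u set \<Rightarrow> 'u) \<Rightarrow> 'u monoid \<Rightarrow> 'u set \<Rightarrow> 'u \<Rightarrow> 'u" where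
  "proj code H I = (\<lambda>x\<in>carrier H. code (I #>\<^bsub>H\<^esub> x))"


section \<open>Ideals, prime ideals and Top couples\<close>

definition ideal_of :: "('u set \<Rightarrow> 'u) \<Rightarrow> 'u group_cat \<Rightarrow> 'u monoid \<Rightarrow> 'u set \<Rightarrow> bool" where
  "ideal_of code C H I \<longleftrightarrow>
     I \<lhd> H \<and> quot code H I \<in> Obj C \<and> proj code H I \<in> Mor C H (quot code H I)"

definition Spec ::
    "('u set \<Rightarrow> 'u) \<Rightarrow> 'u group_cat \<Rightarrow> 'u monoid set \<Rightarrow> 'u monoid \<Rightarrow> 'u set set" where
  "Spec code C D H =
     {P. ideal_of code C H P \<and> P \<noteq> carrier H \<and> quot code H P \<in> D}"

definition preim :: "'u monoid \<Rightarrow> ('u \<Rightarrow> 'u) \<Rightarrow> 'u set \<Rightarrow> 'u set" where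
  "preim H f P = {x \<in> carrier H. f x \<in> P}"

definition comm_subgroup :: "'u monoid \<Rightarrow> 'u set \<Rightarrow> 'u set \<Rightarrow> 'u set" where
  "comm_subgroup H U V = \<Inter>{N. N \<lhd> H \<and>
     (\<forall>u\<in>U. \<forall>v\<in>V. u \<otimes>\<^bsub>H\<^esub> v \<otimes>\<^bsub>H\<^esub> inv\<^bsub>H\<^esub> u \<otimes>\<^bsub>H\<^esub> inv\<^bsub>H\<^esub> v \<in> N)}"

definition top_couple :: "('u set \<Rightarrow> 'u) \<Rightarrow> 'u group_cat \<Rightarrow> 'u monoid set \<Rightarrow> bool" where
  "top_couple code C D \<longleftrightarrow>
     group_subcategory C \<and> coset_coding code C \<and> D \<subseteq> Obj C \<and>
     (\<forall>L\<in>Obj C. \<forall>L'\<in>D. (\<exists>f\<in>Mor C L L'. inj_on f (carrier L)) \<longrightarrow> L \<in> D) \<and>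
     (\<forall>L\<in>D. \<forall>I J. I \<lhd> L \<longrightarrow> J \<lhd> L \<longrightarrow> comm_subgroup L I J = {\<one>\<^bsub>L\<^esub>} \<longrightarrow>
        I = {\<one>\<^bsub>L\<^esub>} \<or> J = {\<one>\<^bsub>L\<^esub>}) \<and>
     (\<forall>H\<in>Obj C. \<forall>H'\<in>Obj C. \<forall>f\<in>Mor C H H'. \<forall>I.
        ideal_of code C H' I \<longrightarrow> ideal_of code C H (preim H f I))"


section \<open>Two closure conditions\<close>

text \<open>
  For an arbitrary Top couple, \<open>f\<^sup>-\<^sup>1(P)\<close> need not be prime when \<open>P\<close> is, for two reasons.

  \<^item> The injection \<open>H/f\<^sup>-\<^sup>1(P) \<rightarrow> H'/P\<close> induced by \<open>f\<close> need not be a morphism of \<open>C\<close>, so that T1 does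
    not apply to it. Example: let \<open>f\<close> map \<open>Z/4\<close> onto a subgroup of order 2 of the alternating group
    \<open>A5\<close>; identify \<open>G/1\<close> with \<open>G\<close>; the objects are \<open>Z/4\<close>, \<open>Q = (Z/4)/2(Z/4)\<close> and \<open>A5\<close>; the
    morphisms are the identities, \<open>f\<close> and the projection \<open>Z/4 \<rightarrow> Q\<close>; and \<open>D = {A5}\<close>. This is a Top
    couple, 1 is prime in \<open>A5\<close>, and \<open>f\<^sup>-\<^sup>1(1) = 2(Z/4)\<close> is not prime because \<open>Q\<close> is not in \<open>D\<close>.

  \<^item> \<open>f\<^sup>-\<^sup>1(P)\<close> can be all of \<open>H\<close>. Example: \<open>C\<close> is the full subcategory of the groups that are
    trivial or isomorphic to \<open>A5\<close>, \<open>D\<close> consists of all objects, \<open>f : A5 \<rightarrow> A5\<close> is the trivial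
    homomorphism and \<open>P = 1\<close>.

  The following conditions exclude these two phenomena. The second one is the analogue of the
  fact that the zero ring has no unital homomorphism to a nonzero ring; it holds in particular if no
  group in \<open>D\<close> is trivial.
\<close>

definition induced_injections ::
    "('u set \<Rightarrow> 'u) \<Rightarrow> 'u group_cat \<Rightarrow> 'u monoid set \<Rightarrow> bool" where
  "induced_injections code C D \<longleftrightarrow>
     (\<forall>G\<in>Obj C. \<forall>L\<in>D. \<forall>I. ideal_of code C G I \<longrightarrow>
       (\<forall>m\<in>ext_hom (quot code G I) L. inj_on m (carrier (quot code G I)) \<longrightarrow>
          compose (carrier G) m (proj code G I) \<in> Mor C G L \<longrightarrow> m \<in> Mor C (quot code G I) L))"

definition no_morphism_from_trivial :: "'u group_cat \<Rightarrow> 'u monoid set \<Rightarrow> bool" where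
  "no_morphism_from_trivial C D \<longleftrightarrow>
     (\<forall>E\<in>Obj C. \<forall>L\<in>D. carrier E = {\<one>\<^bsub>E\<^esub>} \<longrightarrow> carrier L \<noteq> {\<one>\<^bsub>L\<^esub>} \<longrightarrow> Mor C E L = {})"


section \<open>The topology of the spectrum\<close>

definition V ::
    "('u set \<Rightarrow> 'u) \<Rightarrow> 'u group_cat \<Rightarrow> 'u monoid set \<Rightarrow> 'u monoid \<Rightarrow> 'u set \<Rightarrow> 'u set set" where
  "V code C D H I = {P \<in> Spec code C D H. I \<subseteq> P}"

text \<open>
  For a Top couple the sets below form a topology: \<open>V(I) \<union> V(J) = V([I,J])\<close> by T2, and an
  intersection of sets \<open>V(I)\<close> is \<open>V(N)\<close> for the normal subgroup \<open>N\<close> generated by the \<open>I\<close>.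
\<close>

definition spec_topology ::
    "('u set \<Rightarrow> 'u) \<Rightarrow> 'u group_cat \<Rightarrow> 'u monoid set \<Rightarrow> 'u monoid \<Rightarrow> 'u set topology" where
  "spec_topology code C D H =
     topology (\<lambda>U. \<exists>I. I \<lhd> H \<and> U = Spec code C D H - V code C D H I)"

end

(* If P is prime in H', then f induces an injective homomorphism H/f^-1(P) \<rightarrow> H'/P.  It is a morphism
   because its composite with H \<rightarrow> H/f^-1(P) is the composite of f with H' \<rightarrow> H'/P, so f^-1(P) is prime
   by T1; it is proper because a trivial quotient H/f^-1(P) has no morphism to the nontrivial H'/P.
   The preimage of V(I) under c(f) is V(J), where J is the normal closure of f(I) in H'. *)

theory Submission
  imports Defs
begin

section \<open>Normal closures\<close>

text \<open>If \<open>S\<close> is not contained in the carrier, the family is empty and the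
  intersection is \<open>UNIV\<close>; hence the hypothesis in
  \<open>normal_closure_normal\<close>.\<close>

definition normal_closure :: "('a, 'b) monoid_scheme \<Rightarrow> 'a set \<Rightarrow> 'a set" where
  "normal_closure G S = \<Inter>{N. N \<lhd> G \<and> S \<subseteq> N}"

lemma (in group) normal_carrier: "carrier G \<lhd> G"
  by (simp add: normal_inv_iff subgroup_self)

lemma (in group) normal_Inter:
  assumes "\<And>N. N \<in> \<N> \<Longrightarrow> N \<lhd> G" and "\<N> \<noteq> {}"
  shows "\<Inter>\<N> \<lhd> G"
  unfolding normal_inv_iff
proof (intro conjI ballI)
  show "subgroup (\<Inter>\<N>) G"
    using assms by (intro subgroups_Inter) (auto dest: normal_imp_subgroup)
qed (use assms in \<open>auto simp: normal_inv_iff\<close>)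

lemma (in group) normal_closure_normal:
  assumes "S \<subseteq> carrier G"
  shows "normal_closure G S \<lhd> G"
  unfolding normal_closure_def using assms normal_carrier by (intro normal_Inter) auto

lemma normal_closure_subset_iff:
  assumes "N \<lhd> G"
  shows "normal_closure G S \<subseteq> N \<longleftrightarrow> S \<subseteq> N"
  using assms unfolding normal_closure_def by blast

section \<open>Commutator subgroups\<close>

lemma comm_subgroup_eq_normal_closure:
  "comm_subgroup G A B = normal_closure G
     ((\<lambda>(a, b). a \<otimes>\<^bsub>G\<^esub> b \<otimes>\<^bsub>G\<^esub> inv\<^bsub>G\<^esub> a \<otimes>\<^bsub>G\<^esub> inv\<^bsub>G\<^esub> b) ` (A \<times> B))"
  unfolding comm_subgroup_def normal_closure_def by (rule arg_cong[of _ _ Inter]) auto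

lemma comm_subgroup_normal:
  assumes "group G" "A \<subseteq> carrier G" "B \<subseteq> carrier G"
  shows "comm_subgroup G A B \<lhd> G"
proof -
  interpret group G by fact
  show ?thesis
    unfolding comm_subgroup_eq_normal_closure
    using assms(2,3) by (intro normal_closure_normal) (auto simp: subset_iff)
qed

lemma comm_subgroup_subset_iff:
  assumes "N \<lhd> G"
  shows "comm_subgroup G A B \<subseteq> N \<longleftrightarrow>
    (\<forall>a\<in>A. \<forall>b\<in>B. a \<otimes>\<^bsub>G\<^esub> b \<otimes>\<^bsub>G\<^esub> inv\<^bsub>G\<^esub> a \<otimes>\<^bsub>G\<^esub> inv\<^bsub>G\<^esub> b \<in> N)"
  unfolding comm_subgroup_eq_normal_closure normal_closure_subset_iff[OF assms] by auto

text \<open>The factor after \<open>u\<close> is a conjugate of \<open>inv u\<close>, so both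
  factors lie in \<open>H\<close>.\<close>

lemma (in normal) commutator_mem_left:
  assumes "u \<in> H" "v \<in> carrier G"
  shows "u \<otimes> v \<otimes> inv u \<otimes> inv v \<in> H"
proof -
  have "u \<otimes> (v \<otimes> inv u \<otimes> inv v) \<in> H"
    using assms by (intro subgroup.m_closed[OF subgroup_axioms] inv_op_closed2) auto
  then show ?thesis
    using assms by (simp add: m_assoc)
qed

text \<open>Here the commutator is a conjugate of \<open>v\<close> times
  \<open>inv v\<close>.\<close>

lemma (in normal) commutator_mem_right:
  assumes "u \<in> carrier G" "v \<in> H"
  shows "u \<otimes> v \<otimes> inv u \<otimes> inv v \<in> H"
  using assms by (intro subgroup.m_closed[OF subgroup_axioms] inv_op_closed2) auto


section \<open>Quotients\<close>

context
  fixes code :: "'u set \<Rightarrow> 'u" and G :: "'u monoid" and N :: "'u set"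
  assumes normal: "N \<lhd> G" and inj: "inj_on code (carrier (G Mod N))"
begin

interpretation normal N G by (rule normal)

lemma quot_group: "group (quot code G N)"
  unfolding quot_def using factorgroup_is_group inj by (rule flatten_set_group)

lemma proj_hom: "proj code G N \<in> hom G (quot code G N)"
proof -
  have "code \<circ> (\<lambda>x. N #>\<^bsub>G\<^esub> x) \<in> hom G (quot code G N)"
    unfolding quot_def
    by (rule Group.hom_compose[OF r_coset_hom_Mod flatten_set_group_hom[OF factorgroup_is_group inj]])
  then show ?thesis
    by (auto simp: hom_def proj_def Pi_iff)
qed

lemma proj_group_hom: "group_hom G (quot code G N) (proj code G N)"
  by (simp add: group_hom_def group_hom_axioms_def is_group quot_group proj_hom)

lemma proj_surj: "proj code G N ` carrier G = carrier (quot code G N)"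
  by (simp add: quot_def flatten_def proj_def carrier_FactGroup image_image)

lemma proj_eq_one_iff:
  assumes "x \<in> carrier G"
  shows "proj code G N x = \<one>\<^bsub>quot code G N\<^esub> \<longleftrightarrow> x \<in> N"
proof -
  have "proj code G N x = \<one>\<^bsub>quot code G N\<^esub> \<longleftrightarrow> code (N #>\<^bsub>G\<^esub> x) = code N"
    using assms by (simp add: proj_def quot_def flatten_def)
  \<comment> \<open>\<open>N\<close> is itself a coset, the unit of \<open>G Mod N\<close>, so
    injectivity of \<open>code\<close> on cosets applies.\<close>
  also have "\<dots> \<longleftrightarrow> N #>\<^bsub>G\<^esub> x = N"
    using assms inj_onD[OF inj, of "N #>\<^bsub>G\<^esub> x" N] group.is_monoid[OF factorgroup_is_group]
      monoid.one_closed[of "G Mod N"] by (auto simp: carrier_FactGroup)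
  also have "\<dots> \<longleftrightarrow> x \<in> N"
    using assms coset_join1 coset_join2 subgroup_axioms rcos_self by metis
  finally show ?thesis .
qed

text \<open>Translates properness of a prime ideal into nontriviality of its quotient, the form in
  which \<open>no_morphism_from_trivial\<close> can be applied.\<close>

lemma quot_trivial_iff: "carrier (quot code G N) = {\<one>\<^bsub>quot code G N\<^esub>} \<longleftrightarrow> N = carrier G"
proof -
  have "carrier G \<noteq> {}"
    using subset one_closed by blast
  then have "carrier (quot code G N) = {\<one>\<^bsub>quot code G N\<^esub>} \<longleftrightarrow>
      (\<forall>x\<in>carrier G. proj code G N x = \<one>\<^bsub>quot code G N\<^esub>)"
    unfolding proj_surj[symmetric] by (auto simp: image_iff)
  then show ?thesis
    using proj_eq_one_iff subset by blast
qed

end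

section \<open>Factoring a homomorphism through a surjection\<close>

lemma (in group_hom) hom_eq_iff_kernel:
  assumes "x \<in> carrier G" "y \<in> carrier G"
  shows "h x = h y \<longleftrightarrow> h (x \<otimes> inv y) = \<one>\<^bsub>H\<^esub>"
  using assms by (metis G.inv_closed H.inv_closed H.inv_equality H.inv_inv H.r_inv hom_closed hom_inv hom_mult)

text \<open>First isomorphism theorem in the form needed here: with equal kernels, \<open>p\<close>
  and \<open>h\<close> identify the same pairs of elements, so \<open>h\<close> descends along the
  surjection \<open>p\<close> to an injection. Extensionality of \<open>h\<close> makes the
  factorization an equality of functions, not only an equality on the carrier.\<close>

lemma injective_hom_of_equal_kernels:
  assumes p: "group_hom G Q p" "p ` carrier G = carrier Q"
    and h: "group_hom G L h" "h \<in> extensional (carrier G)"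
    and kernels: "\<And>x. x \<in> carrier G \<Longrightarrow> p x = \<one>\<^bsub>Q\<^esub> \<longleftrightarrow> h x = \<one>\<^bsub>L\<^esub>"
  obtains m where "m \<in> ext_hom Q L" "inj_on m (carrier Q)" "compose (carrier G) m p = h"
proof -
  interpret p: group_hom G Q p by (rule p)
  interpret h: group_hom G L h by (rule h)
  have eq: "p x = p y \<longleftrightarrow> h x = h y" if "x \<in> carrier G" "y \<in> carrier G" for x y
    using that by (simp add: p.hom_eq_iff_kernel h.hom_eq_iff_kernel kernels del: p.hom_mult h.hom_mult)
  \<comment> \<open>An arbitrary preimage under \<open>p\<close> is chosen; the next fact shows that
    the value does not depend on it. The restriction to \<open>carrier Q\<close> makes
    \<open>m\<close> extensional, as \<open>ext_hom\<close> demands.\<close>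
  define m where "m = (\<lambda>z\<in>carrier Q. h (inv_into (carrier G) p z))"
  have m: "m (p x) = h x" if "x \<in> carrier G" for x
    using that eq f_inv_into_f[of "p x" p "carrier G"] inv_into_into[of "p x" p "carrier G"]
    by (simp add: m_def)
  show thesis
  proof
    have "m \<in> hom Q L"
    proof (rule homI)
      fix y z assume "y \<in> carrier Q" "z \<in> carrier Q"
      then obtain a b where ab: "a \<in> carrier G" "b \<in> carrier G" "y = p a" "z = p b"
        using p(2) by blast
      then show "m y \<in> carrier L"
        by (simp add: m)
      have "m (p (a \<otimes>\<^bsub>G\<^esub> b)) = m (p a) \<otimes>\<^bsub>L\<^esub> m (p b)"
        using ab by (simp add: m del: p.hom_mult)
      then show "m (y \<otimes>\<^bsub>Q\<^esub> z) = m y \<otimes>\<^bsub>L\<^esub> m z"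
        using ab by simp
    qed
    then show "m \<in> ext_hom Q L"
      by (simp add: ext_hom_def m_def)
    show "inj_on m (carrier Q)"
      unfolding p(2)[symmetric] by (auto simp: inj_on_def m eq)
    show "compose (carrier G) m p = h"
      using h(2) by (auto simp: compose_def m extensional_def)
  qed
qed


section \<open>The topology of the spectrum\<close>

context
  fixes code :: "'u set \<Rightarrow> 'u" and C :: "'u group_cat" and D :: "'u monoid set"
  assumes top_couple: "top_couple code C D"
begin

lemma Obj_group: "H \<in> Obj C \<Longrightarrow> group H"
  using top_couple by (simp add: top_couple_def group_subcategory_def)

lemma Mor_ext_hom: "\<lbrakk>G \<in> Obj C; H \<in> Obj C; f \<in> Mor C G H\<rbrakk> \<Longrightarrow> f \<in> ext_hom G H"
  using top_couple by (auto simp: top_couple_def group_subcategory_def)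

lemma Mor_compose:
  "\<lbrakk>G \<in> Obj C; H \<in> Obj C; K \<in> Obj C; f \<in> Mor C G H; g \<in> Mor C H K\<rbrakk>
    \<Longrightarrow> compose (carrier G) g f \<in> Mor C G K"
  using top_couple by (simp add: top_couple_def group_subcategory_def)

lemma code_inj: "\<lbrakk>H \<in> Obj C; N \<lhd> H\<rbrakk> \<Longrightarrow> inj_on code (carrier (H Mod N))"
  using top_couple by (simp add: top_couple_def coset_coding_def)

lemma Obj_D: "L \<in> D \<Longrightarrow> L \<in> Obj C"
  using top_couple by (auto simp: top_couple_def)

lemma T1: "\<lbrakk>L \<in> Obj C; L' \<in> D; f \<in> Mor C L L'; inj_on f (carrier L)\<rbrakk> \<Longrightarrow> L \<in> D"
  using top_couple unfolding top_couple_def by blast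

lemma T2: "\<lbrakk>L \<in> D; I \<lhd> L; J \<lhd> L; comm_subgroup L I J = {\<one>\<^bsub>L\<^esub>}\<rbrakk> \<Longrightarrow> I = {\<one>\<^bsub>L\<^esub>} \<or> J = {\<one>\<^bsub>L\<^esub>}"
  using top_couple unfolding top_couple_def by blast

lemma T3:
  "\<lbrakk>H \<in> Obj C; H' \<in> Obj C; f \<in> Mor C H H'; ideal_of code C H' I\<rbrakk> \<Longrightarrow> ideal_of code C H (preim H f I)"
  using top_couple unfolding top_couple_def by blast

lemma Spec_normal: "P \<in> Spec code C D H \<Longrightarrow> P \<lhd> H"
  by (simp add: Spec_def ideal_of_def)

text \<open>The analogue of "a prime contains a product of ideals iff it contains a factor".
  Containment in \<open>P\<close> becomes triviality in the quotient by \<open>P\<close>, where T2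
  applies because this quotient lies in \<open>D\<close>.\<close>

lemma comm_subgroup_subset_prime_iff:
  assumes H: "H \<in> Obj C" and P: "P \<in> Spec code C D H" and IJ: "I \<lhd> H" "J \<lhd> H"
  shows "comm_subgroup H I J \<subseteq> P \<longleftrightarrow> I \<subseteq> P \<or> J \<subseteq> P"
proof
  have N: "P \<lhd> H" using P by (rule Spec_normal)
  have sub: "I \<subseteq> carrier H" "J \<subseteq> carrier H"
    using IJ by (auto dest: normal_imp_subgroup subgroup.subset)
  note inj = code_inj[OF H N]
  let ?Q = "quot code H P" and ?p = "proj code H P"
  interpret p: group_hom H ?Q ?p
    by (rule proj_group_hom[OF N inj])
  {
    assume "I \<subseteq> P \<or> J \<subseteq> P"
    then show "comm_subgroup H I J \<subseteq> P"
      unfolding comm_subgroup_subset_iff[OF N]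
      using sub normal.commutator_mem_left[OF N] normal.commutator_mem_right[OF N] by blast
  next
    assume comm: "comm_subgroup H I J \<subseteq> P"
    \<comment> \<open>Surjectivity of the projection is what keeps the images normal.\<close>
    have images: "?p ` I \<lhd> ?Q" "?p ` J \<lhd> ?Q"
      using IJ proj_surj[OF N inj] by (auto intro: normal.surj_hom_normal_subgroup p.group_hom_axioms)
    have "comm_subgroup ?Q (?p ` I) (?p ` J) \<subseteq> {\<one>\<^bsub>?Q\<^esub>}"
      unfolding comm_subgroup_subset_iff[OF p.H.one_is_normal]
    proof clarify
      fix i j assume ij: "i \<in> I" "j \<in> J"
      then have car: "i \<in> carrier H" "j \<in> carrier H" using sub by auto
      have "i \<otimes>\<^bsub>H\<^esub> j \<otimes>\<^bsub>H\<^esub> inv\<^bsub>H\<^esub> i \<otimes>\<^bsub>H\<^esub> inv\<^bsub>H\<^esub> j \<in> P"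
        using comm ij unfolding comm_subgroup_subset_iff[OF N] by blast
      then have "?p (i \<otimes>\<^bsub>H\<^esub> j \<otimes>\<^bsub>H\<^esub> inv\<^bsub>H\<^esub> i \<otimes>\<^bsub>H\<^esub> inv\<^bsub>H\<^esub> j) = \<one>\<^bsub>?Q\<^esub>"
        using car by (simp add: proj_eq_one_iff[OF N inj] del: p.hom_mult)
      then show "?p i \<otimes>\<^bsub>?Q\<^esub> ?p j \<otimes>\<^bsub>?Q\<^esub> inv\<^bsub>?Q\<^esub> ?p i \<otimes>\<^bsub>?Q\<^esub> inv\<^bsub>?Q\<^esub> ?p j = \<one>\<^bsub>?Q\<^esub>"
        using car by simp
    qed
    \<comment> \<open>T2 asks for equality with the trivial subgroup, so the inclusion above is
      complemented by membership of the unit.\<close>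
    moreover have "\<one>\<^bsub>?Q\<^esub> \<in> comm_subgroup ?Q (?p ` I) (?p ` J)"
      by (intro subgroup.one_closed normal_imp_subgroup comm_subgroup_normal p.H.is_group)
        (use images in \<open>auto dest: normal_imp_subgroup subgroup.subset\<close>)
    ultimately have "?p ` I = {\<one>\<^bsub>?Q\<^esub>} \<or> ?p ` J = {\<one>\<^bsub>?Q\<^esub>}"
      using P images by (intro T2) (auto simp: Spec_def)
    \<comment> \<open>A subgroup with trivial image lies in the kernel of the projection, which is
      \<open>P\<close>.\<close>
    then show "I \<subseteq> P \<or> J \<subseteq> P"
      using sub proj_eq_one_iff[OF N inj] by blast
  }
qed

lemma V_comm_subgroup:
  assumes "H \<in> Obj C" "I \<lhd> H" "J \<lhd> H"
  shows "V code C D H (comm_subgroup H I J) = V code C D H I \<union> V code C D H J"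
  using comm_subgroup_subset_prime_iff[OF assms(1) _ assms(2,3)] by (auto simp: V_def)

text \<open>Primes are normal, so they contain \<open>S\<close> as soon as they contain its normal
  closure, and conversely. Closed sets may thus be described by arbitrary generating sets.\<close>

lemma V_normal_closure: "V code C D H (normal_closure H S) = V code C D H S"
  unfolding V_def using normal_closure_subset_iff[OF Spec_normal] by blast

lemma istopology_Spec:
  assumes H: "H \<in> Obj C"
  shows "istopology (\<lambda>U. \<exists>I. I \<lhd> H \<and> U = Spec code C D H - V code C D H I)"
  unfolding istopology_def
proof (intro conjI allI impI)
  interpret group H using H by (rule Obj_group)
  fix S T
  assume "\<exists>I. I \<lhd> H \<and> S = Spec code C D H - V code C D H I"
    and "\<exists>I. I \<lhd> H \<and> T = Spec code C D H - V code C D H I"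
  then obtain I J where IJ: "I \<lhd> H" "S = Spec code C D H - V code C D H I"
      "J \<lhd> H" "T = Spec code C D H - V code C D H J"
    by blast
  have "comm_subgroup H I J \<lhd> H"
    using IJ(1,3) by (intro comm_subgroup_normal is_group) (auto dest: normal_imp_subgroup subgroup.subset)
  moreover have "S \<inter> T = Spec code C D H - V code C D H (comm_subgroup H I J)"
    by (simp add: V_comm_subgroup[OF H IJ(1,3)] IJ(2,4) Diff_Un)
  ultimately show "\<exists>I. I \<lhd> H \<and> S \<inter> T = Spec code C D H - V code C D H I"
    by (intro exI conjI)
next
  interpret group H using H by (rule Obj_group)
  fix \<K> assume *: "\<forall>K\<in>\<K>. \<exists>I. I \<lhd> H \<and> K = Spec code C D H - V code C D H I"
  \<comment> \<open>Taking all normal subgroups that give a member of \<open>\<K>\<close> avoids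
    choosing one for each member.\<close>
  define \<I> where "\<I> = {I. I \<lhd> H \<and> Spec code C D H - V code C D H I \<in> \<K>}"
  have "\<K> = (\<lambda>I. Spec code C D H - V code C D H I) ` \<I>"
    using * by (auto simp: \<I>_def image_iff)
  then have "\<Union>\<K> = (\<Union>I\<in>\<I>. Spec code C D H - V code C D H I)"
    by simp
  \<comment> \<open>A prime contains the union iff it contains each member. For empty
    \<open>\<I>\<close> both sides are empty.\<close>
  also have "\<dots> = Spec code C D H - V code C D H (\<Union>\<I>)"
    unfolding V_def by blast
  finally have "\<Union>\<K> = Spec code C D H - V code C D H (normal_closure H (\<Union>\<I>))"
    by (simp add: V_normal_closure)
  moreover have "normal_closure H (\<Union>\<I>) \<lhd> H"
    unfolding \<I>_def by (intro normal_closure_normal) (auto dest: normal_imp_subgroup subgroup.subset)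
  ultimately show "\<exists>I. I \<lhd> H \<and> \<Union>\<K> = Spec code C D H - V code C D H I"
    by blast
qed

lemma openin_spec_topology:
  assumes "H \<in> Obj C"
  shows "openin (spec_topology code C D H) U \<longleftrightarrow>
    (\<exists>I. I \<lhd> H \<and> U = Spec code C D H - V code C D H I)"
  unfolding spec_topology_def topology_inverse'[OF istopology_Spec[OF assms]] ..

lemma topspace_spec_topology:
  assumes H: "H \<in> Obj C"
  shows "topspace (spec_topology code C D H) = Spec code C D H"
proof -
  interpret group H using H by (rule Obj_group)
  \<comment> \<open>Prime ideals are proper, so the whole spectrum is one of the basic open
    sets.\<close>
  have "V code C D H (carrier H) = {}"
    by (auto simp: V_def Spec_def ideal_of_def dest: normal_imp_subgroup subgroup.subset)
  then have "openin (spec_topology code C D H) (Spec code C D H)"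
    unfolding openin_spec_topology[OF H] using normal_carrier by blast
  moreover have "U \<subseteq> Spec code C D H" if "openin (spec_topology code C D H) U" for U
    using that unfolding openin_spec_topology[OF H] by blast
  ultimately show ?thesis
    by (metis openin_subset openin_topspace subset_antisym)
qed

section \<open>Preimages of prime ideals\<close>

lemma preim_Spec:
  assumes induced: "induced_injections code C D" and triv: "no_morphism_from_trivial C D"
    and H: "H \<in> Obj C" and H': "H' \<in> Obj C" and f: "f \<in> Mor C H H'"
    and P: "P \<in> Spec code C D H'"
  shows "preim H f P \<in> Spec code C D H"
proof -
  let ?I = "preim H f P"
  let ?Q = "quot code H ?I" and ?L = "quot code H' P"
  let ?h = "compose (carrier H) (proj code H' P) f"
  have P': "ideal_of code C H' P" "P \<noteq> carrier H'" "?L \<in> D"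
    using P by (auto simp: Spec_def)
  have N: "P \<lhd> H'" and projM: "proj code H' P \<in> Mor C H' ?L"
    using P'(1) by (auto simp: ideal_of_def)
  note injP = code_inj[OF H' N]
  have I: "ideal_of code C H ?I"
    using H H' f P'(1) by (rule T3)
  then have NI: "?I \<lhd> H" and Q: "?Q \<in> Obj C"
    by (auto simp: ideal_of_def)
  note injI = code_inj[OF H NI]
  have L: "?L \<in> Obj C" using P'(3) by (rule Obj_D)
  have hM: "?h \<in> Mor C H ?L"
    using H H' L f projM by (rule Mor_compose)
  have "group_hom H ?L ?h" "?h \<in> extensional (carrier H)"
    using Mor_ext_hom[OF H L hM] Obj_group[OF H] Obj_group[OF L]
    by (auto simp: ext_hom_def group_hom_def group_hom_axioms_def)
  \<comment> \<open>Both equations say that \<open>f x\<close> lies in \<open>P\<close>, so the two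
    maps have the same kernel \<open>?I\<close>.\<close>
  moreover have "proj code H ?I x = \<one>\<^bsub>?Q\<^esub> \<longleftrightarrow> ?h x = \<one>\<^bsub>?L\<^esub>" if x: "x \<in> carrier H" for x
  proof -
    have "f x \<in> carrier H'"
      using Mor_ext_hom[OF H H' f] x by (auto simp: ext_hom_def hom_def)
    moreover have "x \<in> ?I \<longleftrightarrow> f x \<in> P"
      using x by (simp add: preim_def)
    ultimately show ?thesis
      using x by (simp add: proj_eq_one_iff[OF NI injI] compose_eq proj_eq_one_iff[OF N injP])
  qed
  ultimately obtain m where m: "m \<in> ext_hom ?Q ?L" "inj_on m (carrier ?Q)"
      "compose (carrier H) m (proj code H ?I) = ?h"
    using injective_hom_of_equal_kernels[OF proj_group_hom[OF NI injI] proj_surj[OF NI injI]]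
    by metis
  \<comment> \<open>\<open>induced_injections\<close> applies because the composite of
    \<open>m\<close> with the projection is \<open>?h\<close>, already known to be a morphism of
    \<open>C\<close>.\<close>
  have mM: "m \<in> Mor C ?Q ?L"
    using induced H P'(3) I m hM unfolding induced_injections_def by metis
  have "?Q \<in> D"
    using Q P'(3) mM m(2) by (rule T1)
  \<comment> \<open>Otherwise \<open>?Q\<close> would be trivial and \<open>m\<close> a morphism
    from it to \<open>?L\<close>, which is nontrivial since \<open>P\<close> is proper.\<close>
  moreover have "?I \<noteq> carrier H"
    using triv Q P' mM quot_trivial_iff[OF NI injI] quot_trivial_iff[OF N injP]
    unfolding no_morphism_from_trivial_def by blast
  ultimately show ?thesis
    using I by (simp add: Spec_def)
qed

end

theorem proposition3p2:
  fixes code :: "'u set \<Rightarrow> 'u"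
    and C :: "'u group_cat"
    and D :: "'u monoid set"
    and H H' :: "'u monoid"
    and f :: "'u \<Rightarrow> 'u"
  assumes "top_couple code C D"
    and "induced_injections code C D"
    and "no_morphism_from_trivial C D"
    and "H \<in> Obj C" and "H' \<in> Obj C"
    and "f \<in> Mor C H H'"
  shows "continuous_map (spec_topology code C D H') (spec_topology code C D H)
           (\<lambda>P. preim H f P)"
proof -
  note tc = assms(1) and H = assms(4) and H' = assms(5) and f = assms(6)
  interpret H': group H' using tc H' by (rule Obj_group)
  have preim: "preim H f P \<in> Spec code C D H" if "P \<in> Spec code C D H'" for P
    using assms that by (rule preim_Spec)
  have "openin (spec_topology code C D H') {P \<in> Spec code C D H'. preim H f P \<in> U}"
    if U: "openin (spec_topology code C D H) U" for U
  proof -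
    obtain I where I: "I \<lhd> H" "U = Spec code C D H - V code C D H I"
      using U unfolding openin_spec_topology[OF tc H] by blast
    have sub: "I \<subseteq> carrier H" using I(1) by (auto dest: normal_imp_subgroup subgroup.subset)
    then have "f ` I \<subseteq> carrier H'"
      using Mor_ext_hom[OF tc H H' f] by (auto simp: ext_hom_def hom_def)
    then have "normal_closure H' (f ` I) \<lhd> H'"
      by (rule H'.normal_closure_normal)
    moreover have "I \<subseteq> preim H f P \<longleftrightarrow> f ` I \<subseteq> P" for P
      using sub by (auto simp: preim_def)
    then have "{P \<in> Spec code C D H'. preim H f P \<in> U} =
        Spec code C D H' - V code C D H' (f ` I)"
      using preim I(2) by (auto simp: V_def)
    ultimately show ?thesis
      unfolding openin_spec_topology[OF tc H'] V_normal_closure[OF tc, symmetric, of H' "f ` I"] by blast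
  qed
  then show ?thesis
    using preim by (simp add: continuous_map_def topspace_spec_topology[OF tc] H H' Pi_iff)
qed

end
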